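(* Let $N>0$ and let $N_T,N_{W1},N_{W2}\ge 0$ be integers with $N_T+N_{W1}+N_{W2}=5$ and $2N_{W1}N_{W2}+4N_T(N_{W1}+N_{W2})>0$. Consider any five-kangaroo algorithm with $N_T$ tame kangaroos starting at positions $q_1,\dots,q_{N_T}$, $N_{W1}$ kangaroos of type Wild1 starting at positions $p_1+z,\dots,p_{N_{W1}}+z$, and $N_{W2}$ kangaroos of type Wild2 starting at positions $r_1-z,\dots,r_{N_{W2}}-z$, where all $q_k,p_k,r_k$ are real constants independent of $z$, and with any average step size $m>0$. Let $d(z)$, for $z\in[0,N)$, denote the initial distance between the closest useful pair of kangaroos. Then the expected number of group operations until the closest useful pair collides, $$E=\frac{1}{N}\int_0^N 5\left(\frac{d(z)}{m}+m\right)dz,$$ satisfies $$E\;\ge\;10\sqrt{\frac{N}{2N_{W1}N_{W2}+4N_T(N_{W1}+N_{W2})}}.$$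
   Context: Setting: the interval discrete logarithm problem asks, given $g,h$ in a group $G$ and $N$ with $h=g^z$ for an unknown $0\le z<N$, to find $z$; a kangaroo algorithm walks several "kangaroos" through $G$. A kangaroo is at position $p$ when its current group element is $g^p$. A Tame kangaroo's elements are expressed as $g^q$, a Wild1 kangaroo's as $g^p h$ (so position $p+z$), a Wild2 kangaroo's as $g^r h^{-1}$ (so position $r-z$). A pair of kangaroos is useful iff the two kangaroos have different types. The initial distance between two kangaroos is the absolute difference of their starting positions, viewed as a function of $z$; $d(z)$ is the minimum of these initial distances over all useful pairs. In the paper's model, for fixed $z$ the expected number of steps until the closest useful pair collides is $d(z)/m+m$, each step costs $5$ group operations (each kangaroo jumps once), and $E$ above is the average of this over $z$ (with the average over $z$ taken as an integral). *)

theory Defs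
  imports "HOL-Analysis.Analysis"
begin

datatype kangaroo_type = Tame | Wild1 | Wild2

text \<open>A kangaroo is a type together with an index among the kangaroos of that type, so that
  kangaroos of equal type and equal starting position stay distinct.\<close>

type_synonym kangaroo = "kangaroo_type \<times> nat"

definition herd :: "nat \<Rightarrow> nat \<Rightarrow> nat \<Rightarrow> kangaroo set" where
  "herd NT NW1 NW2 = {Tame} \<times> {1..NT} \<union> {Wild1} \<times> {1..NW1} \<union> {Wild2} \<times> {1..NW2}"

text \<open>Positions are exponents of \<open>g\<close>. With \<open>h = g\<^sup>z\<close>, the group elements
  \<open>g\<^sup>q\<close>, \<open>g\<^sup>p h\<close> and \<open>g\<^sup>r h\<^sup>-\<^sup>1\<close> of a Tame, Wild1 and Wild2 kangaroo have
  positions \<open>q\<close>, \<open>p + z\<close> and \<open>r - z\<close>.\<close>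

fun start_pos ::
  "(nat \<Rightarrow> real) \<Rightarrow> (nat \<Rightarrow> real) \<Rightarrow> (nat \<Rightarrow> real) \<Rightarrow> kangaroo \<Rightarrow> real \<Rightarrow> real" where
  "start_pos q p r (Tame, k) z = q k"
| "start_pos q p r (Wild1, k) z = p k + z"
| "start_pos q p r (Wild2, k) z = r k - z"

definition useful_pairs :: "kangaroo set \<Rightarrow> (kangaroo \<times> kangaroo) set" where
  "useful_pairs K = {(a, b). a \<in> K \<and> b \<in> K \<and> fst a \<noteq> fst b}"

definition initial_distance :: "(kangaroo \<Rightarrow> real \<Rightarrow> real) \<Rightarrow> kangaroo \<Rightarrow> kangaroo \<Rightarrow> real \<Rightarrow> real" where
  "initial_distance s a b z = \<bar>s a z - s b z\<bar>"

text \<open>Only meaningful if \<open>K\<close> is finite and has a useful pair.\<close>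

definition closest_useful_distance :: "(kangaroo \<Rightarrow> real \<Rightarrow> real) \<Rightarrow> kangaroo set \<Rightarrow> real \<Rightarrow> real" where
  "closest_useful_distance s K z = Min ((\<lambda>(a, b). initial_distance s a b z) ` useful_pairs K)"

text \<open>Expected number of steps until two kangaroos at initial distance \<open>\<delta>\<close> collide, for average
  step size \<open>m\<close>: about \<open>\<delta> / m\<close> steps until the rear one reaches the starting point of the front
  one, and \<open>m\<close> further steps until it lands on a point visited by the other.\<close>

definition expected_steps :: "real \<Rightarrow> real \<Rightarrow> real" where
  "expected_steps m \<delta> = \<delta> / m + m"

text \<open>In each step each of the five kangaroos jumps once, at one group operation per jump. The
  unknown \<open>z\<close> is averaged over the real interval from \<open>0\<close> to \<open>N\<close>.\<close>

definition expected_group_operations :: "real \<Rightarrow> real \<Rightarrow> (real \<Rightarrow> real) \<Rightarrow> real" where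
  "expected_group_operations N m d = 1 / N * integral {0..N} (\<lambda>z. 5 * expected_steps m (d z))"

end

theory Submission
  imports Defs
begin

text \<open>Fix a threshold \<open>T > 0\<close>. At every \<open>z\<close> some useful pair realises \<open>d z\<close>, so \<open>d z\<close> is at
  least \<open>T\<close> minus the sum over all unordered useful pairs of the tents \<open>max 0 (T - \<bar>u z + v\<bar>)\<close>,
  where \<open>\<bar>u z + v\<bar>\<close> is the distance of the pair. A tent has integral at most \<open>T\<^sup>2 / \<bar>u\<bar>\<close>, and
  \<open>\<bar>u\<bar>\<close> is 1 for a tame-wild pair and 2 for a Wild1-Wild2 pair. Hence the integral of \<open>d\<close> is at
  least \<open>N T - C T\<^sup>2\<close>, where \<open>C\<close> is the sum of the \<open>1 / \<bar>u\<bar>\<close>. The choice \<open>T = N / (2 C)\<close>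
  gives \<open>N\<^sup>2 / (4 C)\<close>, and AM-GM for the two terms containing \<open>m\<close> finishes the proof.\<close>

text \<open>Supplies a primitive of the ramp \<open>max 0 x\<close> that is valid at the kink too,
  so that integrating a tent later needs no splitting of the interval.\<close>

lemma DERIV_max_0_square:
  "((\<lambda>x::real. (max 0 x)\<^sup>2 / 2) has_real_derivative max 0 x) (at x)"
proof -
  consider "x < 0" | "x = 0" | "x > 0" by linarith
  then show ?thesis
  proof cases
    case 1
    have "((\<lambda>x::real. 0) has_real_derivative max 0 x) (at x)"
      using 1 by simp
    then show ?thesis
      by (rule has_field_derivative_transform_within_open[where S = "{..<0}"]) (use 1 in auto)
  next
    case 2
    \<comment> \<open>Caratheodory's criterion at the kink: the difference quotient is
      \<open>max 0 z / 2\<close>, which is continuous and vanishes at 0.\<close>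
    have "(max 0 z)\<^sup>2 / 2 - (max 0 0)\<^sup>2 / 2 = max 0 z / 2 * (z - 0)" for z :: real
      by (auto simp: max_def power2_eq_square)
    moreover have "isCont (\<lambda>z::real. max 0 z / 2) 0"
      by (intro continuous_intros) auto
    ultimately show ?thesis
      unfolding 2 by (subst CARAT_DERIV) (rule exI[of _ "\<lambda>z. max 0 z / 2"], simp)
  next
    case 3
    have "((\<lambda>x::real. x\<^sup>2 / 2) has_real_derivative max 0 x) (at x)"
      using 3 by (auto intro!: derivative_eq_intros)
    then show ?thesis
      by (rule has_field_derivative_transform_within_open[where S = "{0<..}"]) (use 3 in auto)
  qed
qed

text \<open>The graph is a triangle of height \<open>T\<close> on a base of length
  \<open>2 * T / \<bar>u\<bar>\<close>. Only an inequality holds because \<open>{a..b}\<close> may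
  cut off part of it.\<close>

lemma integral_tent_le:
  fixes a b T u v :: real
  assumes "a \<le> b" "T > 0" "u \<noteq> 0"
  shows "integral {a..b} (\<lambda>z. max 0 (T - \<bar>u * z + v\<bar>)) \<le> T\<^sup>2 / \<bar>u\<bar>"
proof -
  have pos: "integral {a..b} (\<lambda>z. max 0 (T - \<bar>u * z + v\<bar>)) \<le> T\<^sup>2 / u" if "u > 0" for u v
  proof -
    \<comment> \<open>The tent is the second difference, with step \<open>T\<close>, of the ramp, so
      the same second difference \<open>F\<close> of a primitive \<open>G\<close> of the ramp is a
      primitive of the tent.\<close>
    define G :: "real \<Rightarrow> real" where "G x = (max 0 x)\<^sup>2 / 2" for x
    define F where "F x = G (x + T) - 2 * G x + G (x - T)" for x
    have G: "(G has_real_derivative max 0 x) (at x)" for x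
      unfolding G_def by (rule DERIV_max_0_square)
    have tent: "max 0 (x + T) - 2 * max 0 x + max 0 (x - T) = max 0 (T - \<bar>x\<bar>)" for x
      using \<open>T > 0\<close> by (auto simp: max_def)
    have F: "(F has_real_derivative max 0 (T - \<bar>x\<bar>)) (at x)" for x
      unfolding F_def tent[symmetric]
      by (auto intro!: derivative_eq_intros DERIV_chain2[OF G] simp: G)
    \<comment> \<open>\<open>F\<close> is 0 left of \<open>- T\<close> and \<open>T\<^sup>2\<close>
      right of \<open>T\<close>. Bounding its values in between bounds every difference of two
      values by \<open>T\<^sup>2\<close>, wherever the endpoints lie.\<close>
    have "F x \<ge> 0 \<and> F x \<le> T\<^sup>2" for x
    proof -
      consider "x \<le> - T" | "- T \<le> x" "x \<le> 0" | "0 \<le> x" "x \<le> T" | "T \<le> x" by linarith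
      then show ?thesis
      proof cases
        case 1
        then show ?thesis using \<open>T > 0\<close> by (simp add: F_def G_def)
      next
        case 2
        have "F x = (x + T)\<^sup>2 / 2" using 2 \<open>T > 0\<close> by (simp add: F_def G_def)
        moreover have "(x + T)\<^sup>2 \<le> T\<^sup>2" using 2 by (intro power_mono) auto
        ultimately show ?thesis using zero_le_power2[of "x + T"] by linarith
      next
        case 3
        have "F x = ((x + T)\<^sup>2 - 2 * x\<^sup>2) / 2"
          using 3 \<open>T > 0\<close> by (simp add: F_def G_def field_simps)
        then have "F x = T\<^sup>2 - (T - x)\<^sup>2 / 2"
          by (simp add: power2_eq_square field_simps)
        moreover have "(T - x)\<^sup>2 \<le> T\<^sup>2" using 3 by (intro power_mono) auto
        ultimately show ?thesis using zero_le_power2[of "T - x"] by linarith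
      next
        case 4
        have "F x = T\<^sup>2"
          using 4 \<open>T > 0\<close> by (simp add: F_def G_def power2_eq_square field_simps)
        then show ?thesis by simp
      qed
    qed
    then have diff: "F (u * b + v) - F (u * a + v) \<le> T\<^sup>2"
      by (smt (verit))
    have "((\<lambda>z. max 0 (T - \<bar>u * z + v\<bar>)) has_integral F (u * b + v) / u - F (u * a + v) / u) {a..b}"
    proof (rule fundamental_theorem_of_calculus[OF \<open>a \<le> b\<close>])
      fix x
      have "((\<lambda>z. F (u * z + v) / u) has_real_derivative max 0 (T - \<bar>u * x + v\<bar>)) (at x)"
        using that by (auto intro!: derivative_eq_intros DERIV_chain2[OF F])
      then show "((\<lambda>z. F (u * z + v) / u) has_vector_derivative max 0 (T - \<bar>u * x + v\<bar>))
                   (at x within {a..b})"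
        by (simp add: has_real_derivative_iff_has_vector_derivative
            has_vector_derivative_at_within)
    qed
    then have "integral {a..b} (\<lambda>z. max 0 (T - \<bar>u * z + v\<bar>))
                 = (F (u * b + v) - F (u * a + v)) / u"
      by (simp add: integral_unique diff_divide_distrib)
    then show ?thesis
      using diff that by (simp add: divide_right_mono)
  qed
  show ?thesis
  proof (cases "u > 0")
    case True
    then show ?thesis using pos[of u v] by simp
  next
    case False
    have "\<bar>- u * z + - v\<bar> = \<bar>u * z + v\<bar>" for z by linarith
    then show ?thesis using pos[of "- u" "- v"] False \<open>u \<noteq> 0\<close> by simp
  qed
qed

text \<open>The tent argument needs only that some member of the family attains \<open>f z\<close>
  at each \<open>z\<close>; that \<open>f\<close> is a minimum does not enter. Continuity provides
  integrability.\<close>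

lemma integral_ge_of_mem_affine_abs:
  fixes u v :: "'i \<Rightarrow> real" and f :: "real \<Rightarrow> real"
  assumes "finite P" "P \<noteq> {}" "N > 0" "continuous_on {0..N} f"
    and u: "\<And>i. i \<in> P \<Longrightarrow> u i \<noteq> 0"
    and f: "\<And>z. z \<in> {0..N} \<Longrightarrow> f z \<in> (\<lambda>i. \<bar>u i * z + v i\<bar>) ` P"
  shows "integral {0..N} f \<ge> N\<^sup>2 / (4 * (\<Sum>i\<in>P. 1 / \<bar>u i\<bar>))"
proof -
  define C where "C = (\<Sum>i\<in>P. 1 / \<bar>u i\<bar>)"
  have "C > 0" unfolding C_def using assms by (intro sum_pos) auto
  \<comment> \<open>This is the maximiser of the quadratic
    \<open>T * N - C * T\<^sup>2\<close>.\<close>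
  define T where "T = N / (2 * C)"
  have "T > 0" using \<open>C > 0\<close> \<open>N > 0\<close> by (simp add: T_def)
  let ?t = "\<lambda>i z. max 0 (T - \<bar>u i * z + v i\<bar>)"
  have int: "?t i integrable_on {0..N}" for i
    by (intro integrable_continuous_interval continuous_intros)
  then have int_sum: "(\<lambda>z. \<Sum>i\<in>P. ?t i z) integrable_on {0..N}"
    using \<open>finite P\<close> by (intro integrable_sum)
  have "N\<^sup>2 / (4 * C) = T * N - C * T\<^sup>2"
    using \<open>C > 0\<close> by (simp add: T_def power2_eq_square field_simps)
  also have "\<dots> = T * N - (\<Sum>i\<in>P. T\<^sup>2 / \<bar>u i\<bar>)"
    by (simp add: C_def sum_distrib_right)
  also have "\<dots> \<le> T * N - (\<Sum>i\<in>P. integral {0..N} (?t i))"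
    using \<open>T > 0\<close> \<open>N > 0\<close> u by (intro diff_left_mono sum_mono integral_tent_le) auto
  also have "\<dots> = integral {0..N} (\<lambda>z. T - (\<Sum>i\<in>P. ?t i z))"
    using \<open>N > 0\<close> \<open>finite P\<close>
    by (subst Henstock_Kurzweil_Integration.integral_diff[OF integrable_const_ivl int_sum])
      (simp add: Henstock_Kurzweil_Integration.integral_sum int)
  also have "\<dots> \<le> integral {0..N} f"
  proof (intro integral_le integrable_diff int_sum integrable_const_ivl)
    show "f integrable_on {0..N}"
      using assms by (intro integrable_continuous_interval)
  next
    fix z assume "z \<in> {0..N}"
    then obtain i where i: "i \<in> P" "f z = \<bar>u i * z + v i\<bar>" using f by blast
    \<comment> \<open>The tent of the attaining index alone is at least \<open>T - f z\<close>, and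
      the other tents are nonnegative.\<close>
    have "?t i z \<le> (\<Sum>i\<in>P. ?t i z)"
      using i \<open>finite P\<close> by (intro member_le_sum) auto
    then show "T - (\<Sum>i\<in>P. ?t i z) \<le> f z"
      using i by linarith
  qed
  finally show ?thesis by (simp add: C_def)
qed

lemma continuous_on_Min_image:
  fixes g :: "'i \<Rightarrow> 'a::topological_space \<Rightarrow> 'b::linorder_topology"
  assumes "finite P" "P \<noteq> {}" "\<And>i. i \<in> P \<Longrightarrow> continuous_on S (g i)"
  shows "continuous_on S (\<lambda>z. Min ((\<lambda>i. g i z) ` P))"
  using assms
  by (induction rule: finite_ne_induct) (auto intro!: continuous_on_min)

text \<open>The coefficient of \<open>z\<close> in the starting position of a kangaroo of the given
  type.\<close>

fun slope :: "kangaroo_type \<Rightarrow> real" where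
  "slope Tame = 0"
| "slope Wild1 = 1"
| "slope Wild2 = - 1"

lemma start_pos_affine: "start_pos q p r a z = slope (fst a) * z + start_pos q p r a 0"
  by (cases a; cases "fst a") auto

text \<open>Makes the distance of a useful pair genuinely depend on \<open>z\<close>, as the tent
  bound requires a nonzero coefficient.\<close>

lemma slope_inject: "slope s = slope t \<longleftrightarrow> s = t"
  by (cases s; cases t) auto

text \<open>\<open>useful_pairs\<close> lists every pair in both orders. Summing tents over it would
  double \<open>C\<close> and weaken the final bound by a factor \<open>sqrt 2\<close>, so one
  orientation is fixed here.\<close>

definition unordered_useful_pairs :: "nat \<Rightarrow> nat \<Rightarrow> nat \<Rightarrow> (kangaroo \<times> kangaroo) set" where
  "unordered_useful_pairs NT NW1 NW2 =
     ({Tame} \<times> {1..NT}) \<times> ({Wild1} \<times> {1..NW1}) \<union>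
     ({Tame} \<times> {1..NT}) \<times> ({Wild2} \<times> {1..NW2}) \<union>
     ({Wild1} \<times> {1..NW1}) \<times> ({Wild2} \<times> {1..NW2})"

lemma finite_unordered_useful_pairs: "finite (unordered_useful_pairs NT NW1 NW2)"
  by (simp add: unordered_useful_pairs_def)

lemma useful_pairs_herd:
  "useful_pairs (herd NT NW1 NW2) =
     unordered_useful_pairs NT NW1 NW2 \<union> prod.swap ` unordered_useful_pairs NT NW1 NW2"
proof (rule set_eqI)
  fix x :: "kangaroo \<times> kangaroo"
  obtain s k t l where x: "x = ((s, k), (t, l))" by (metis surj_pair)
  show "x \<in> useful_pairs (herd NT NW1 NW2) \<longleftrightarrow>
      x \<in> unordered_useful_pairs NT NW1 NW2 \<union> prod.swap ` unordered_useful_pairs NT NW1 NW2"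
    unfolding x
    by (cases s; cases t)
      (simp_all add: useful_pairs_def herd_def unordered_useful_pairs_def pair_in_swap_image conj_commute)
qed

text \<open>Distance is symmetric, so the swapped pairs contribute no new values to the
  minimum.\<close>

lemma closest_useful_distance_herd:
  "closest_useful_distance s (herd NT NW1 NW2) z =
     Min ((\<lambda>(a, b). initial_distance s a b z) ` unordered_useful_pairs NT NW1 NW2)"
proof -
  have "(\<lambda>(a, b). initial_distance s a b z) ` prod.swap ` P =
        (\<lambda>(a, b). initial_distance s a b z) ` P" for P
    by (auto simp: image_image initial_distance_def abs_minus_commute intro!: image_cong)
  then show ?thesis
    by (simp add: closest_useful_distance_def useful_pairs_herd image_Un)
qed

text \<open>Each tame-wild pair contributes 1 and each Wild1-Wild2 pair 1/2. This is where the
  weights 4 and 2 in the theorem come from.\<close>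

lemma sum_inverse_slope_unordered_useful_pairs:
  "(\<Sum>(a, b)\<in>unordered_useful_pairs NT NW1 NW2. 1 / \<bar>slope (fst a) - slope (fst b)\<bar>) =
     real (2 * NW1 * NW2 + 4 * NT * (NW1 + NW2)) / 4"
proof -
  have block: "(\<Sum>(a, b)\<in>({s} \<times> {1..k}) \<times> ({t} \<times> {1..l}). 1 / \<bar>slope (fst a) - slope (fst b)\<bar>) =
      real k * real l / \<bar>slope s - slope t\<bar>" for s t and k l :: nat
  proof -
    have "(\<Sum>(a, b)\<in>({s} \<times> {1..k}) \<times> ({t} \<times> {1..l}). 1 / \<bar>slope (fst a) - slope (fst b)\<bar>) =
        (\<Sum>_\<in>({s} \<times> {1..k}) \<times> ({t} \<times> {1..l}). 1 / \<bar>slope s - slope t\<bar>)"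
      by (intro sum.cong) auto
    then show ?thesis by (simp add: card_cartesian_product)
  qed
  show ?thesis
    unfolding unordered_useful_pairs_def
    apply (subst sum.union_disjoint, simp, simp, blast)
    apply (subst sum.union_disjoint, simp, simp, blast)
    apply (simp only: block)
    apply (simp add: field_simps)
    done
qed

theorem theorem3p2:
  fixes N m :: real and NT NW1 NW2 :: nat and q p r :: "nat \<Rightarrow> real"
  assumes "N > 0"
    and "NT + NW1 + NW2 = 5"
    and "2 * NW1 * NW2 + 4 * NT * (NW1 + NW2) > 0"
    and "m > 0"
  shows "expected_group_operations N m
           (closest_useful_distance (start_pos q p r) (herd NT NW1 NW2))
         \<ge> 10 * sqrt (N / real (2 * NW1 * NW2 + 4 * NT * (NW1 + NW2)))"
proof -
  define D where "D = real (2 * NW1 * NW2 + 4 * NT * (NW1 + NW2))"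
  have "D > 0" using assms(3) unfolding D_def by (simp only: of_nat_0_less_iff)
  define P where "P = unordered_useful_pairs NT NW1 NW2"
  define d where "d = closest_useful_distance (start_pos q p r) (herd NT NW1 NW2)"
  define u where "u = (\<lambda>(a::kangaroo, b::kangaroo). slope (fst a) - slope (fst b))"
  define v where "v = (\<lambda>(a, b). start_pos q p r a 0 - start_pos q p r b 0)"
  have "finite P" by (simp add: P_def finite_unordered_useful_pairs)
  have sum: "(\<Sum>i\<in>P. 1 / \<bar>u i\<bar>) = D / 4"
    using sum_inverse_slope_unordered_useful_pairs[of NT NW1 NW2]
    by (simp add: P_def u_def D_def case_prod_unfold)
  \<comment> \<open>An empty \<open>P\<close> would make the sum 0, against
    \<open>D > 0\<close>.\<close>
  have "P \<noteq> {}" using sum \<open>D > 0\<close> by auto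
  have dist: "(\<lambda>(a, b). initial_distance (start_pos q p r) a b z) = (\<lambda>i. \<bar>u i * z + v i\<bar>)" for z
    by (auto simp: fun_eq_iff u_def v_def initial_distance_def start_pos_affine[of q p r _ z]
        algebra_simps)
  have d: "d z = Min ((\<lambda>i. \<bar>u i * z + v i\<bar>) ` P)" for z
    by (simp add: d_def closest_useful_distance_herd P_def dist)
  have cont: "continuous_on {0..N} d"
    unfolding d using \<open>finite P\<close> \<open>P \<noteq> {}\<close>
    by (intro continuous_on_Min_image continuous_intros)
  have "N\<^sup>2 / (4 * (\<Sum>i\<in>P. 1 / \<bar>u i\<bar>)) \<le> integral {0..N} d"
  proof (rule integral_ge_of_mem_affine_abs[OF \<open>finite P\<close> \<open>P \<noteq> {}\<close> \<open>N > 0\<close> cont])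
    show "u i \<noteq> 0" if "i \<in> P" for i
      using that by (auto simp: P_def unordered_useful_pairs_def u_def slope_inject)
    show "d z \<in> (\<lambda>i. \<bar>u i * z + v i\<bar>) ` P" for z
      unfolding d using \<open>finite P\<close> \<open>P \<noteq> {}\<close> by (intro Min_in) auto
  qed
  then have int_d: "N\<^sup>2 / D \<le> integral {0..N} d" by (simp add: sum)
  have "d integrable_on {0..N}" using cont by (rule integrable_continuous_interval)
  then have "((\<lambda>z. 5 * expected_steps m (d z)) has_integral
               5 * (integral {0..N} d / m + m * N)) {0..N}" (is "(?e has_integral _) _")
    unfolding expected_steps_def
    using \<open>N > 0\<close> has_integral_const_real[of m 0 N]
    by (intro has_integral_mult_right has_integral_add has_integral_divide integrable_integral)
      (simp_all add: mult.commute)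
  then have "integral {0..N} ?e = 5 * (integral {0..N} d / m + m * N)"
    by (rule integral_unique)
  then have E: "expected_group_operations N m d = 5 * (integral {0..N} d / N / m + m)"
    unfolding expected_group_operations_def using \<open>N > 0\<close> by (simp only:) (simp add: field_simps)
  have "N / D \<le> integral {0..N} d / N"
    using int_d \<open>N > 0\<close> by (simp add: field_simps power2_eq_square)
  then have avg: "N / D / m \<le> integral {0..N} d / N / m"
    using \<open>m > 0\<close> by (intro divide_right_mono) auto
  \<comment> \<open>The two terms have a product free of \<open>m\<close>, so AM-GM gives a bound
    uniform in the step size. Its factor 2 and the five jumps per step make the constant 10.\<close>
  have "sqrt (N / D) = sqrt (N / D / m * m)" using \<open>m > 0\<close> by simp
  also have "\<dots> \<le> (N / D / m + m) / 2"
    using \<open>N > 0\<close> \<open>D > 0\<close> \<open>m > 0\<close> by (intro arith_geo_mean_sqrt) auto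
  finally show ?thesis
    using avg unfolding d_def[symmetric] E D_def[symmetric] by simp
qed

end
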